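(* Let $\mathcal{X}$ and $\mathcal{U}$ be nonempty compact sets and let $f:\mathcal{X}\times\mathcal{U}\to\mathbb{R}$ be a bounded function that is upper semicontinuous in its first argument and lower semicontinuous in its second argument. Suppose that $\mathcal{U}$ is a convex set and that $\theta\mapsto f(x,\theta)$ is a convex function on $\mathcal{U}$ for every $x\in\mathcal{X}$. If $\eta=\min_{\theta\in\mathcal{U}}\max_{x\in\mathcal{X}}f(x,\theta)$, then $$\max_{x\in\mathcal{X}}\min_{\theta\in\mathcal{U}_\eta}f(x,\theta)=\min_{\theta\in\mathcal{U}}\max_{x\in\mathcal{X}}f(x,\theta),$$ where $\mathcal{U}_\eta=\{\theta\in\mathcal{U}:\max_{x'\in\mathcal{X}}f(x',\theta)\le\eta\}$.
   Context: $\mathcal{X}$ is a subset of a topological space and $\mathcal{U}$ is a subset of a real vector space equipped with a topology; both may be infinite-dimensional. Compact means every open cover has a finite subcover. Semicontinuity in an argument means semicontinuity of the function of that argument when the other argument is fixed. For $\eta\in\mathbb{R}$ the reduced uncertainty set is $\mathcal{U}_\eta:=\{\theta\in\mathcal{U}:\max_{x'\in\mathcal{X}}f(x',\theta)\le\eta\}=\{\theta\in\mathcal{U}:f(x',\theta)\le\eta\ \forall x'\in\mathcal{X}\}$. Under the stated assumptions all maxima and minima appearing in the claim are attained. *)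

theory Defs
  imports "HOL-Analysis.Analysis"
begin

text \<open>
  Semicontinuity is relative to \<open>S\<close> (with the subspace topology); it does not depend on the
  values of \<open>g\<close> outside \<open>S\<close>.
\<close>

definition upper_semicontinuous_on :: "'a::topological_space set \<Rightarrow> ('a \<Rightarrow> real) \<Rightarrow> bool"
  where "upper_semicontinuous_on S g \<longleftrightarrow>
    (\<forall>x\<in>S. \<forall>c. g x < c \<longrightarrow> (\<forall>\<^sub>F y in at x within S. g y < c))"

definition lower_semicontinuous_on :: "'a::topological_space set \<Rightarrow> ('a \<Rightarrow> real) \<Rightarrow> bool"
  where "lower_semicontinuous_on S g \<longleftrightarrow>
    (\<forall>x\<in>S. \<forall>c. c < g x \<longrightarrow> (\<forall>\<^sub>F y in at x within S. c < g y))"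

text \<open>
  \<open>max_over\<close> and \<open>min_over\<close> are meaningful only when the extremum is attained, which
  \<open>attains_max\<close> and \<open>attains_min\<close> express; otherwise their values are unspecified.
\<close>

definition attains_max :: "'a set \<Rightarrow> ('a \<Rightarrow> real) \<Rightarrow> bool"
  where "attains_max S g \<longleftrightarrow> (\<exists>x\<in>S. \<forall>y\<in>S. g y \<le> g x)"

definition attains_min :: "'a set \<Rightarrow> ('a \<Rightarrow> real) \<Rightarrow> bool"
  where "attains_min S g \<longleftrightarrow> (\<exists>x\<in>S. \<forall>y\<in>S. g x \<le> g y)"

definition max_over :: "'a set \<Rightarrow> ('a \<Rightarrow> real) \<Rightarrow> real"
  where "max_over S g = (GREATEST v. v \<in> g ` S)"

definition min_over :: "'a set \<Rightarrow> ('a \<Rightarrow> real) \<Rightarrow> real"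
  where "min_over S g = (LEAST v. v \<in> g ` S)"

definition reduced_uncertainty_set ::
    "'a set \<Rightarrow> 'b set \<Rightarrow> ('a \<Rightarrow> 'b \<Rightarrow> real) \<Rightarrow> real \<Rightarrow> 'b set"
  where "reduced_uncertainty_set X U f \<eta> = {\<theta>\<in>U. max_over X (\<lambda>x. f x \<theta>) \<le> \<eta>}"

end

theory Submission
  imports Defs
begin

text \<open>
  For finitely many points of \<open>U\<^sub>\<eta>\<close>, a convex combination \<open>\<theta>\<close> with positive weights again lies in
  \<open>U\<^sub>\<eta>\<close>, and some \<open>x\<close> satisfies \<open>f x \<theta> \<ge> \<eta>\<close>. As \<open>f x \<le> \<eta>\<close> on \<open>U\<^sub>\<eta>\<close>, convexity forces \<open>f x = \<eta>\<close> at each of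
  the given points. Hence the sets \<open>{x \<in> X. \<eta> \<le> f x \<theta>}\<close> for \<open>\<theta> \<in> U\<^sub>\<eta>\<close>, which are closed in \<open>X\<close>,
  have the finite intersection property, and a point in their intersection is a maximizer.
\<close>

text \<open>Sign reversal carries results on sublevel sets and minima over to superlevel sets and
  maxima.\<close>

lemma lower_semicontinuous_on_uminus_iff:
  "lower_semicontinuous_on S (\<lambda>x. - g x) \<longleftrightarrow> upper_semicontinuous_on S g"
proof -
  have "(\<forall>c. c < - g x \<longrightarrow> (\<forall>\<^sub>F y in F. c < - g y)) \<longleftrightarrow> (\<forall>c. g x < c \<longrightarrow> (\<forall>\<^sub>F y in F. g y < c))" for x F
  proof safe
    show "\<forall>\<^sub>F y in F. g y < c" if "\<forall>c. c < - g x \<longrightarrow> (\<forall>\<^sub>F y in F. c < - g y)" "g x < c" for c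
      using that(1)[rule_format, of "- c"] that(2) by simp
    show "\<forall>\<^sub>F y in F. c < - g y" if "\<forall>c. g x < c \<longrightarrow> (\<forall>\<^sub>F y in F. g y < c)" "c < - g x" for c
      using that(1)[rule_format, of "- c"] that(2) by (simp add: less_minus_iff)
  qed
  then show ?thesis
    unfolding lower_semicontinuous_on_def upper_semicontinuous_on_def by simp
qed

lemma lower_semicontinuous_on_subset:
  assumes "lower_semicontinuous_on S g" "T \<subseteq> S"
  shows "lower_semicontinuous_on T g"
  using assms unfolding lower_semicontinuous_on_def
  by (blast intro: filter_leD[OF at_le[OF assms(2)]])

text \<open>Lower semicontinuity makes the strict superlevel set open in \<open>S\<close>, and the
  sublevel set is its complement in \<open>S\<close>.\<close>

lemma closedin_sublevel:
  assumes "lower_semicontinuous_on S g"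
  shows "closedin (top_of_set S) {x\<in>S. g x \<le> c}"
proof -
  have "openin (top_of_set S) {x\<in>S. c < g x}"
  proof (subst openin_subopen, intro ballI)
    fix x assume "x \<in> {x\<in>S. c < g x}"
    then have x: "x \<in> S" "c < g x" by auto
    then have "\<forall>\<^sub>F y in at x within S. c < g y"
      using assms unfolding lower_semicontinuous_on_def by blast
    then obtain T where T: "open T" "x \<in> T" "\<forall>y\<in>T. y \<noteq> x \<longrightarrow> y \<in> S \<longrightarrow> c < g y"
      unfolding eventually_at_topological by blast
    have "openin (top_of_set S) (S \<inter> T)" using T by (simp add: openin_open_Int)
    \<comment> \<open>The filter \<open>at x within S\<close> says nothing about \<open>x\<close>
      itself, where \<open>c < g x\<close> is already known.\<close>
    moreover have "S \<inter> T \<subseteq> {x\<in>S. c < g x}" using T x by auto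
    ultimately show "\<exists>T. openin (top_of_set S) T \<and> x \<in> T \<and> T \<subseteq> {x\<in>S. c < g x}"
      using x T by blast
  qed
  moreover have "{x\<in>S. g x \<le> c} = S - {x\<in>S. c < g x}" by auto
  ultimately show ?thesis by (simp add: closedin_def Diff_Diff_Int Int_absorb1)
qed

lemma closedin_superlevel:
  assumes "upper_semicontinuous_on S g"
  shows "closedin (top_of_set S) {x\<in>S. c \<le> g x}"
  using closedin_sublevel[of S "\<lambda>x. - g x" "- c"] assms
  by (simp add: lower_semicontinuous_on_uminus_iff)

text \<open>Without a Hausdorff hypothesis, a set closed in \<open>S\<close> may fail to be closed
  in the whole space. So each \<open>A i\<close> is written as \<open>S \<inter> C i\<close> with
  \<open>C i\<close> closed, and compactness is applied to the \<open>C i\<close>. Taking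
  \<open>F = {}\<close> in \<open>fip\<close> also makes \<open>S\<close> nonempty, which matters
  when \<open>I\<close> is empty.\<close>

lemma compact_closedin_fip:
  assumes "compact S" and cl: "\<And>i. i \<in> I \<Longrightarrow> closedin (top_of_set S) (A i)"
    and fip: "\<And>F. finite F \<Longrightarrow> F \<subseteq> I \<Longrightarrow> \<exists>x\<in>S. \<forall>i\<in>F. x \<in> A i"
  shows "\<exists>x\<in>S. \<forall>i\<in>I. x \<in> A i"
proof -
  have "\<forall>i\<in>I. \<exists>C. closed C \<and> A i = S \<inter> C" using cl by (meson closedin_closed)
  then obtain C where C: "\<And>i. i \<in> I \<Longrightarrow> closed (C i) \<and> A i = S \<inter> C i" by metis
  have "S \<inter> \<Inter> (C ` I) \<noteq> {}"
  proof (rule compact_imp_fip_image[OF assms(1)])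
    show "closed (C i)" if "i \<in> I" for i using C that by blast
    show "S \<inter> \<Inter> (C ` F) \<noteq> {}" if F: "finite F" "F \<subseteq> I" for F
    proof -
      obtain x where "x \<in> S" "\<forall>i\<in>F. x \<in> A i" using fip[OF F] by blast
      then have "x \<in> S \<inter> \<Inter> (C ` F)" using C F(2) by blast
      then show ?thesis by blast
    qed
  qed
  then show ?thesis using C by blast
qed

text \<open>A minimizer is a point common to all the sublevel sets
  \<open>{x\<in>S. g x \<le> g y}\<close>. Among finitely many \<open>y\<close>, one with the least
  value lies in all of theirs.\<close>

lemma attains_min_compact:
  assumes "compact S" "S \<noteq> {}" "lower_semicontinuous_on S g"
  shows "attains_min S g"
proof -
  have "\<exists>x\<in>S. \<forall>y\<in>S. x \<in> {x\<in>S. g x \<le> g y}"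
  proof (rule compact_closedin_fip[OF assms(1)])
    show "closedin (top_of_set S) {x\<in>S. g x \<le> g y}" for y
      using closedin_sublevel[OF assms(3)] .
    show "\<exists>x\<in>S. \<forall>y\<in>F. x \<in> {x\<in>S. g x \<le> g y}" if F: "finite F" "F \<subseteq> S" for F
    proof (cases "F = {}")
      case False
      then obtain x where "x \<in> F" "\<forall>y\<in>F. g x \<le> g y"
        using F(1) by (metis arg_min_if_finite(1) arg_min_least)
      then show ?thesis using F(2) by blast
    qed (use assms(2) in auto)
  qed
  then show ?thesis by (auto simp: attains_min_def)
qed

lemma attains_max_compact:
  assumes "compact S" "S \<noteq> {}" "upper_semicontinuous_on S g"
  shows "attains_max S g"
  using attains_min_compact[of S "\<lambda>x. - g x"] assms
  by (simp add: lower_semicontinuous_on_uminus_iff attains_min_def attains_max_def)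

lemma max_over_eqI:
  assumes "x \<in> S" "\<And>y. y \<in> S \<Longrightarrow> g y \<le> g x"
  shows "max_over S g = g x"
  unfolding max_over_def using assms by (intro Greatest_equality) auto

lemma min_over_eqI:
  assumes "x \<in> S" "\<And>y. y \<in> S \<Longrightarrow> g x \<le> g y"
  shows "min_over S g = g x"
  unfolding min_over_def using assms by (intro Least_equality) auto

lemma attains_maxE:
  assumes "attains_max S g"
  obtains x where "x \<in> S" "max_over S g = g x" "\<And>y. y \<in> S \<Longrightarrow> g y \<le> max_over S g"
proof -
  obtain x where x: "x \<in> S" "\<And>y. y \<in> S \<Longrightarrow> g y \<le> g x"
    using assms unfolding attains_max_def by blast
  with max_over_eqI[of x S g] show ?thesis using that by simp
qed

lemma attains_minE:
  assumes "attains_min S g"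
  obtains x where "x \<in> S" "min_over S g = g x" "\<And>y. y \<in> S \<Longrightarrow> min_over S g \<le> g y"
proof -
  obtain x where x: "x \<in> S" "\<And>y. y \<in> S \<Longrightarrow> g x \<le> g y"
    using assms unfolding attains_min_def by blast
  with min_over_eqI[of x S g] show ?thesis using that by simp
qed

lemma max_over_le_iff:
  assumes "attains_max S g"
  shows "max_over S g \<le> c \<longleftrightarrow> (\<forall>x\<in>S. g x \<le> c)"
proof -
  obtain x where "x \<in> S" "max_over S g = g x" "\<And>y. y \<in> S \<Longrightarrow> g y \<le> max_over S g"
    using attains_maxE[OF assms] by blast
  then show ?thesis by force
qed

text \<open>An \<open>x\<close> attaining the maximum at \<theta> keeps \<open>f x\<close> above
  \<open>c\<close> near \<theta>, and the maximum dominates \<open>f x\<close> at every point of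
  \<open>U\<close>.\<close>

lemma lower_semicontinuous_on_max_over:
  assumes max: "\<And>\<theta>. \<theta> \<in> U \<Longrightarrow> attains_max X (\<lambda>x. f x \<theta>)"
    and lsc: "\<And>x. x \<in> X \<Longrightarrow> lower_semicontinuous_on U (f x)"
  shows "lower_semicontinuous_on U (\<lambda>\<theta>. max_over X (\<lambda>x. f x \<theta>))"
  unfolding lower_semicontinuous_on_def
proof (intro ballI allI impI)
  fix \<theta> c assume \<theta>: "\<theta> \<in> U" "c < max_over X (\<lambda>x. f x \<theta>)"
  then obtain x where x: "x \<in> X" "c < f x \<theta>" using attains_maxE[OF max] by metis
  then have "\<forall>\<^sub>F t in at \<theta> within U. c < f x t"
    using lsc \<theta>(1) unfolding lower_semicontinuous_on_def by blast
  moreover have "\<forall>\<^sub>F t in at \<theta> within U. t \<in> U" by (simp add: eventually_at_filter)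
  ultimately show "\<forall>\<^sub>F t in at \<theta> within U. c < max_over X (\<lambda>x. f x t)"
    by eventually_elim (use x(1) max in \<open>meson attains_maxE less_le_trans\<close>)
qed

text \<open>Points of \<open>F\<close> are absorbed one at a time by taking midpoints: if two
  numbers are at most \<eta> and their average is at least \<eta>, both equal \<eta>. The resulting
  nested midpoint takes the place of one convex combination of all the points.\<close>

lemma exists_point_forcing_superlevel:
  fixes V :: "'b::real_vector set"
  assumes "convex V" "V \<noteq> {}"
    and conv: "\<And>x. x \<in> X \<Longrightarrow> convex_on V (f x)"
    and le: "\<And>x \<theta>. x \<in> X \<Longrightarrow> \<theta> \<in> V \<Longrightarrow> f x \<theta> \<le> \<eta>"
    and "finite F" "F \<subseteq> V"
  shows "\<exists>\<theta>\<in>V. \<forall>x\<in>X. \<eta> \<le> f x \<theta> \<longrightarrow> (\<forall>t\<in>F. \<eta> \<le> f x t)"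
  using \<open>finite F\<close> \<open>F \<subseteq> V\<close>
proof (induction F)
  case empty
  then show ?case using \<open>V \<noteq> {}\<close> by auto
next
  case (insert s F)
  then obtain \<theta> where \<theta>: "\<theta> \<in> V" "\<forall>x\<in>X. \<eta> \<le> f x \<theta> \<longrightarrow> (\<forall>t\<in>F. \<eta> \<le> f x t)" by auto
  have s: "s \<in> V" using insert.prems by simp
  define m where "m = (1 - 1/2) *\<^sub>R \<theta> + (1/2) *\<^sub>R s"
  have "m \<in> V"
    unfolding m_def using convexD_alt[OF \<open>convex V\<close> \<theta>(1) s, of "1/2"] by simp
  moreover have "\<eta> \<le> f x \<theta> \<and> \<eta> \<le> f x s" if "x \<in> X" "\<eta> \<le> f x m" for x
  proof -
    have "f x m \<le> (1 - 1/2) * f x \<theta> + 1/2 * f x s"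
      unfolding m_def using convex_onD[OF conv[OF that(1)], of "1/2" \<theta> s] \<theta>(1) s by simp
    then show ?thesis using that le[OF that(1) \<theta>(1)] le[OF that(1) s] by simp
  qed
  ultimately show ?case using \<theta>(2) by blast
qed

theorem theorem1:
  fixes X :: "'a::topological_space set"
    and U :: "'b::{real_vector,topological_space} set"
    and f :: "'a \<Rightarrow> 'b \<Rightarrow> real"
    and \<eta> :: real
  assumes "X \<noteq> {}" and "compact X"
    and "U \<noteq> {}" and "compact U"
    and "bounded ((\<lambda>(x, \<theta>). f x \<theta>) ` (X \<times> U))"
    and "\<And>\<theta>. \<theta> \<in> U \<Longrightarrow> upper_semicontinuous_on X (\<lambda>x. f x \<theta>)"
    and "\<And>x. x \<in> X \<Longrightarrow> lower_semicontinuous_on U (\<lambda>\<theta>. f x \<theta>)"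
    and "convex U"
    and "\<And>x. x \<in> X \<Longrightarrow> convex_on U (\<lambda>\<theta>. f x \<theta>)"
    and "\<eta> = min_over U (\<lambda>\<theta>. max_over X (\<lambda>x. f x \<theta>))"
  shows "(\<forall>\<theta>\<in>U. attains_max X (\<lambda>x. f x \<theta>))
    \<and> attains_min U (\<lambda>\<theta>. max_over X (\<lambda>x. f x \<theta>))
    \<and> (\<forall>x\<in>X. attains_min (reduced_uncertainty_set X U f \<eta>) (\<lambda>\<theta>. f x \<theta>))
    \<and> attains_max X (\<lambda>x. min_over (reduced_uncertainty_set X U f \<eta>) (\<lambda>\<theta>. f x \<theta>))
    \<and> max_over X (\<lambda>x. min_over (reduced_uncertainty_set X U f \<eta>) (\<lambda>\<theta>. f x \<theta>))
        = min_over U (\<lambda>\<theta>. max_over X (\<lambda>x. f x \<theta>))"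
proof -
  let ?M = "\<lambda>\<theta>. max_over X (\<lambda>x. f x \<theta>)"
  let ?V = "reduced_uncertainty_set X U f \<eta>"
  let ?m = "\<lambda>x. min_over ?V (f x)"
  have max: "attains_max X (\<lambda>x. f x \<theta>)" if "\<theta> \<in> U" for \<theta>
    using attains_max_compact assms(1,2,6) that by blast
  have lscM: "lower_semicontinuous_on U ?M"
    using max assms(7) by (rule lower_semicontinuous_on_max_over)
  have minM: "attains_min U ?M"
    using attains_min_compact[OF assms(4,3) lscM] .
  \<comment> \<open>The minimizer \<open>t\<close> will show that the reduced set is nonempty. The
    lower bound \<eta> will supply, for each \<theta> in \<open>U\<close>, some \<open>x\<close>
    with \<open>f x \<theta>\<close> at least \<eta>.\<close>
  obtain t where t: "t \<in> U" "\<eta> = ?M t" and \<eta>: "\<And>\<theta>. \<theta> \<in> U \<Longrightarrow> \<eta> \<le> ?M \<theta>"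
    using attains_minE[OF minM] assms(10) by metis
  have V: "?V = {\<theta>\<in>U. ?M \<theta> \<le> \<eta>}" by (rule reduced_uncertainty_set_def)
  have ne: "?V \<noteq> {}" using V t by auto
  have VU: "?V \<subseteq> U" using V by blast
  have "compact ?V"
    using assms(4) closedin_sublevel[OF lscM, of \<eta>] unfolding V by (rule closedin_compact)
  then have min: "attains_min ?V (f x)" if "x \<in> X" for x
    using attains_min_compact ne lower_semicontinuous_on_subset[OF assms(7)[OF that] VU] by blast
  have le: "f x \<theta> \<le> \<eta>" if "x \<in> X" "\<theta> \<in> ?V" for x \<theta>
    using that max_over_le_iff[OF max] V by blast
  \<comment> \<open>The bound by \<eta> is checked for each \<open>x\<close> separately, where
    convexity of \<open>f x\<close> applies.\<close>
  have "convex ?V"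
  proof (rule convexI)
    fix a b and u v :: real
    assume ab: "a \<in> ?V" "b \<in> ?V" and uv: "0 \<le> u" "0 \<le> v" "u + v = 1"
    let ?c = "u *\<^sub>R a + v *\<^sub>R b"
    have c: "?c \<in> U" using ab VU uv assms(8) by (auto intro: convexD)
    moreover have "f x ?c \<le> \<eta>" if "x \<in> X" for x
    proof -
      have "f x ?c \<le> u * f x a + v * f x b"
        using assms(9)[OF that] subsetD[OF VU ab(1)] subsetD[OF VU ab(2)] uv
        unfolding convex_on_def by blast
      also have "\<dots> \<le> \<eta>"
        using le[OF that ab(1)] le[OF that ab(2)] uv by (intro convex_bound_le) auto
      finally show ?thesis .
    qed
    ultimately show "?c \<in> ?V" using V max_over_le_iff[OF max[OF c]] by blast
  qed
  have "\<exists>x\<in>X. \<forall>\<theta>\<in>?V. x \<in> {x\<in>X. \<eta> \<le> f x \<theta>}"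
  proof (rule compact_closedin_fip[OF assms(2)])
    show "closedin (top_of_set X) {x\<in>X. \<eta> \<le> f x \<theta>}" if "\<theta> \<in> ?V" for \<theta>
      using closedin_superlevel assms(6) VU that by blast
    fix F assume F: "finite F" "F \<subseteq> ?V"
    obtain \<theta> where \<theta>: "\<theta> \<in> ?V" "\<forall>x\<in>X. \<eta> \<le> f x \<theta> \<longrightarrow> (\<forall>t\<in>F. \<eta> \<le> f x t)"
      using exists_point_forcing_superlevel[where X = X and f = f, OF \<open>convex ?V\<close> ne _ le F]
        convex_on_subset[OF assms(9) VU \<open>convex ?V\<close>] by blast
    \<comment> \<open>A maximizer of \<open>f\<close> over \<open>X\<close> at \<theta> serves as
      \<open>x\<close>; the choice of \<theta> then puts it in the superlevel set of every point of
      \<open>F\<close>.\<close>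
    obtain x where "x \<in> X" "\<eta> \<le> f x \<theta>"
      using \<eta> \<theta>(1) VU attains_maxE[OF max] by (metis subsetD)
    then show "\<exists>x\<in>X. \<forall>t\<in>F. x \<in> {x\<in>X. \<eta> \<le> f x t}" using \<theta>(2) by blast
  qed
  then obtain x where x: "x \<in> X" "\<And>\<theta>. \<theta> \<in> ?V \<Longrightarrow> \<eta> \<le> f x \<theta>" by blast
  have m_le: "?m y \<le> \<eta>" if "y \<in> X" for y
    using attains_minE[OF min[OF that]] le[OF that] by metis
  \<comment> \<open>On \<open>?V\<close> the function \<open>f x\<close> is bounded by \<eta> from
    both sides, so it is constant there.\<close>
  have mx: "?m x = \<eta>"
    using attains_minE[OF min[OF x(1)]] x le by (metis order_antisym)
  have "attains_max X ?m"
    unfolding attains_max_def using x(1) m_le by (intro bexI[of _ x]) (auto simp: mx)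
  moreover have "max_over X ?m = \<eta>"
    using max_over_eqI[of x X ?m] x(1) m_le mx by simp
  ultimately show ?thesis using max minM min assms(10) by auto
qed

end
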